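(* Let $\beta\geq 1$ and let $X=(X(t))_{t\geq 0}$ be a real-valued (càdlàg) Lévy process with the $\beta$-scaling property, that is, $a^{-1/\beta}X(at)$ and $X(t)$ are equal in distribution for all $t,a>0$. Suppose that $X(1)$ is a random variable whose probability density function is non-vanishing almost everywhere on $\mathbb{R}$, i.e. it is $0$ only on a set of Lebesgue measure $0$. Then almost surely $$\dim_{\mathrm{A}} G_X^{[0,1]}=2 .$$
   Context: Lévy process: a stochastic process $X(t)$, $t\geq 0$, such that (1) $X(0)=0$ almost surely; (2) $X(t+h)-X(t)$ is equal in distribution to $X(h)$ for all $t,h>0$; (3) for all $0<t_1<\dots<t_k$ the increments $X(t_i)-X(t_{i-1})$ (with $t_0=0$) are independent; (4) for all $t>0$, $X(t+h)-X(t)\to 0$ in probability as $h\to 0$. It is taken in its càdlàg version (almost surely right continuous with left limits). Graph: for a càdlàg function $X$ and an interval $I$, $G_X^{I}=\{(t,y): y=X(t),\ t\in I\}\cup J$, where $J$ is the union of the vertical segments joining $(t,X(t-))$ to $(t,X(t))$ over the discontinuities $t\in I$ of $X$ ($X(t-)$ is the left limit). Assouad dimension: a non-empty compact set $F\subset\mathbb{R}^2$ is $s$-homogeneous if there is $C>0$ such that for all $R>0$, $r\in(0,R]$ and $x\in F$, $N(B(x,R)\cap F,r)\leq C(R/r)^s$, where $B(x,R)$ is the closed ball of centre $x$ and radius $R$ and $N(E,r)$ is the number of squares of the $r\times r$ grid that intersect $E$. Then $\dim_{\mathrm{A}}F=\inf\{s\geq 0: F\text{ is } s\text{-homogeneous}\}$.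 *)

theory Defs
  imports "HOL-Probability.Probability"
begin

text \<open>Processes are indexed by \<^typ>\<open>real\<close>; only the values at times \<open>t \<ge> 0\<close> are
  constrained or used. In \<open>stochastic_continuity\<close> the limit \<open>h \<rightarrow> 0\<close> is two-sided; since
  \<open>t > 0\<close>, only nonnegative times \<open>t + h\<close> matter.\<close>

locale levy_process = prob_space M
  for M :: "'w measure" and X :: "real \<Rightarrow> 'w \<Rightarrow> real" +
  assumes random_variable: "\<And>t. t \<ge> 0 \<Longrightarrow> random_variable borel (X t)"
    and start_zero: "AE \<omega> in M. X 0 \<omega> = 0"
    and stationary_increments:
      "\<And>t h. t > 0 \<Longrightarrow> h > 0 \<Longrightarrow>
         distr M borel (\<lambda>\<omega>. X (t + h) \<omega> - X t \<omega>) = distr M borel (X h)"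
    and independent_increments:
      "\<And>(k::nat) (t::nat \<Rightarrow> real). t 0 = 0 \<Longrightarrow> (\<And>i. i < k \<Longrightarrow> t i < t (Suc i)) \<Longrightarrow>
         indep_vars (\<lambda>_. borel) (\<lambda>i \<omega>. X (t i) \<omega> - X (t (i - 1)) \<omega>) {1..k}"
    and stochastic_continuity:
      "\<And>t \<epsilon>. t > 0 \<Longrightarrow> \<epsilon> > 0 \<Longrightarrow>
         ((\<lambda>h. prob {\<omega> \<in> space M. \<bar>X (t + h) \<omega> - X t \<omega>\<bar> > \<epsilon>}) \<longlongrightarrow> 0) (at 0)"

definition cadlag :: "(real \<Rightarrow> real) \<Rightarrow> bool" where
  "cadlag f \<longleftrightarrow>
     (\<forall>t\<ge>0. continuous (at_right t) f) \<and> (\<forall>t>0. \<exists>l. (f \<longlongrightarrow> l) (at_left t))"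

definition scaling_property :: "'w measure \<Rightarrow> real \<Rightarrow> (real \<Rightarrow> 'w \<Rightarrow> real) \<Rightarrow> bool" where
  "scaling_property M \<beta> X \<longleftrightarrow>
     (\<forall>t>0. \<forall>a>0. distr M borel (\<lambda>\<omega>. a powr (- 1 / \<beta>) * X (a * t) \<omega>) = distr M borel (X t))"

text \<open>Discontinuity is taken relative to the time domain \<open>{0..}\<close>, so that a right continuous
  function has no jump at time \<open>0\<close>.\<close>

definition discontinuities :: "(real \<Rightarrow> real) \<Rightarrow> real set" where
  "discontinuities f = {t. t \<ge> 0 \<and> \<not> continuous (at t within {0..}) f}"

definition cadlag_graph :: "real set \<Rightarrow> (real \<Rightarrow> real) \<Rightarrow> (real \<times> real) set" where
  "cadlag_graph I f =
     {(t, y). t \<in> I \<and> y = f t} \<union>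
     (\<Union>t \<in> I \<inter> discontinuities f. closed_segment (t, Lim (at_left t) f) (t, f t))"

definition grid_squares :: "real \<Rightarrow> (real \<times> real) set set" where
  "grid_squares r =
     {{of_int i * r .. (of_int i + 1) * r} \<times> {of_int j * r .. (of_int j + 1) * r} | i j :: int. True}"

definition grid_count :: "(real \<times> real) set \<Rightarrow> real \<Rightarrow> nat" where
  "grid_count E r = card {Q \<in> grid_squares r. Q \<inter> E \<noteq> {}}"

definition homogeneous :: "real \<Rightarrow> (real \<times> real) set \<Rightarrow> bool" where
  "homogeneous s F \<longleftrightarrow>
     (\<exists>C>0. \<forall>R>0. \<forall>r\<in>{0<..R}. \<forall>x\<in>F. real (grid_count (cball x R \<inter> F) r) \<le> C * (R / r) powr s)"

text \<open>The infimum is over a set that is bounded below and non-empty, every subset of the plane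
  being \<open>2\<close>-homogeneous, so it is meaningful as a real number.\<close>

definition assouad_dim :: "(real \<times> real) set \<Rightarrow> real" where
  "assouad_dim F = Inf {s. s \<ge> 0 \<and> homogeneous s F}"

end

theory Submission
  imports Defs
begin

text \<open>Cut \<open>[0,1]\<close> into \<open>m\<close> blocks of \<open>n\<close> columns of width \<open>\<tau> = 1 / (m n)\<close>. By scaling, the increments
  of \<open>X\<close> over the columns, divided by \<open>\<tau> powr (1 / \<beta>)\<close>, are independent copies of \<open>X 1\<close>, so
  within each block they follow a prescribed zigzag with a probability \<open>p > 0\<close> that does not
  depend on \<open>m\<close>; letting \<open>m\<close> grow, almost surely some block does. Since \<open>\<tau> \<le> \<tau> powr (1 / \<beta>)\<close> for
  \<open>\<beta> \<ge> 1\<close>, in such a block the graph, whose jumps are filled in, crosses a common vertical range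
  of length \<open>n \<tau>\<close> in every column, and so meets \<open>n\<^sup>2\<close> grid squares of side \<open>\<tau>\<close> in a ball of
  radius \<open>2 n \<tau>\<close>. As \<open>n\<close> is arbitrary, the dimension is at least 2.\<close>

section \<open>Grid counts and the Assouad dimension\<close>

definition grid_interval :: "real \<Rightarrow> int \<Rightarrow> real set" where
  "grid_interval r i = {of_int i * r .. (of_int i + 1) * r}"

definition grid_square :: "real \<Rightarrow> int \<times> int \<Rightarrow> (real \<times> real) set" where
  "grid_square r = (\<lambda>(i, j). grid_interval r i \<times> grid_interval r j)"

lemma grid_squares_eq_range: "grid_squares r = range (grid_square r)"
  by (auto simp: grid_squares_def grid_square_def grid_interval_def)

lemma inj_grid_square:
  assumes "r > 0"
  shows "inj (grid_square r)"
proof (rule injI)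
  fix p q assume "grid_square r p = grid_square r q"
  moreover have "grid_interval r i \<noteq> {}" for i
    using assms by (simp add: grid_interval_def)
  ultimately have "grid_interval r (fst p) = grid_interval r (fst q)"
    "grid_interval r (snd p) = grid_interval r (snd q)"
    by (auto simp: grid_square_def times_eq_iff split: prod.splits)
  then show "p = q"
    using assms by (auto simp: grid_interval_def Icc_eq_Icc prod_eq_iff)
qed

definition grid_indices :: "real \<Rightarrow> real \<Rightarrow> real \<Rightarrow> int set" where
  "grid_indices r a b = {i. grid_interval r i \<inter> {a..b} \<noteq> {}}"

lemma grid_indices_subset:
  assumes "r > 0"
  shows "grid_indices r a b \<subseteq> {\<lceil>a / r\<rceil> - 1..\<lfloor>b / r\<rfloor>}"
proof
  fix i assume "i \<in> grid_indices r a b"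
  then have "of_int i * r \<le> b" "a \<le> (of_int i + 1) * r"
    by (auto simp: grid_indices_def grid_interval_def)
  then have "of_int i \<le> b / r" "a / r \<le> of_int (i + 1)"
    using assms by (simp_all add: field_simps)
  then show "i \<in> {\<lceil>a / r\<rceil> - 1..\<lfloor>b / r\<rfloor>}"
    using ceiling_le[of "a / r" "i + 1"] by (simp add: le_floor_iff)
qed

lemma finite_grid_indices: "r > 0 \<Longrightarrow> finite (grid_indices r a b)"
  by (rule finite_subset[OF grid_indices_subset]) auto

lemma card_grid_indices_le:
  assumes "r > 0" "a \<le> b"
  shows "real (card (grid_indices r a b)) \<le> (b - a) / r + 2"
proof -
  have "card (grid_indices r a b) \<le> card {\<lceil>a / r\<rceil> - 1..\<lfloor>b / r\<rfloor>}"
    using grid_indices_subset[OF assms(1)] by (rule card_mono[rotated]) simp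
  also have "\<dots> = nat (\<lfloor>b / r\<rfloor> - \<lceil>a / r\<rceil> + 2)"
    by simp
  finally have "card (grid_indices r a b) \<le> nat (\<lfloor>b / r\<rfloor> - \<lceil>a / r\<rceil> + 2)" .
  moreover have "a / r \<le> b / r"
    using assms by (simp add: divide_right_mono)
  ultimately show ?thesis
    by (simp add: diff_divide_distrib) linarith
qed

lemma grid_squares_meeting_subset:
  assumes "E \<subseteq> {a..b} \<times> {c..d}"
  shows "{Q \<in> grid_squares r. Q \<inter> E \<noteq> {}} \<subseteq> grid_square r ` (grid_indices r a b \<times> grid_indices r c d)"
  using assms by (fastforce simp: grid_squares_eq_range grid_square_def grid_indices_def)

lemma grid_count_le_rectangle:
  assumes "r > 0" "a \<le> b" "c \<le> d" "E \<subseteq> {a..b} \<times> {c..d}"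
  shows "real (grid_count E r) \<le> ((b - a) / r + 2) * ((d - c) / r + 2)"
proof -
  let ?I = "grid_indices r a b" and ?J = "grid_indices r c d"
  have "grid_count E r \<le> card (?I \<times> ?J)"
    unfolding grid_count_def using assms finite_grid_indices
    by (intro surj_card_le[OF _ grid_squares_meeting_subset]) auto
  then have "real (grid_count E r) \<le> real (card ?I) * real (card ?J)"
    by (metis card_cartesian_product of_nat_le_iff of_nat_mult)
  also have "\<dots> \<le> ((b - a) / r + 2) * ((d - c) / r + 2)"
    using assms by (intro mult_mono card_grid_indices_le) auto
  finally show ?thesis .
qed

lemma cball_subset_rectangle:
  fixes x :: "real \<times> real"
  shows "cball x R \<subseteq> {fst x - R..fst x + R} \<times> {snd x - R..snd x + R}"
proof
  fix z assume "z \<in> cball x R"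
  then have "dist (fst x) (fst z) \<le> R" "dist (snd x) (snd z) \<le> R"
    using dist_fst_le[of x z] dist_snd_le[of x z] by auto
  then show "z \<in> {fst x - R..fst x + R} \<times> {snd x - R..snd x + R}"
    by (auto simp: dist_real_def mem_Times_iff abs_le_iff)
qed

lemma card_le_grid_count:
  assumes "r > 0" "bounded E" "\<And>p. p \<in> P \<Longrightarrow> grid_square r p \<inter> E \<noteq> {}"
  shows "card P \<le> grid_count E r"
proof -
  have "card P = card (grid_square r ` P)"
    using inj_grid_square[OF assms(1)] by (metis card_image inj_on_subset subset_UNIV)
  also have "\<dots> \<le> grid_count E r"
    unfolding grid_count_def
  proof (rule card_mono)
    obtain x R where "E \<subseteq> cball x R"
      using assms(2) by (auto simp: bounded_subset_cball)
    from grid_squares_meeting_subset[OF order_trans[OF this cball_subset_rectangle]]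
    show "finite {Q \<in> grid_squares r. Q \<inter> E \<noteq> {}}"
      by (rule finite_subset) (simp add: finite_grid_indices assms(1))
  qed (use assms(3) in \<open>auto simp: grid_squares_eq_range\<close>)
  finally show ?thesis .
qed

lemma homogeneous_two: "homogeneous 2 F"
proof -
  have "real (grid_count (cball x R \<inter> F) r) \<le> 16 * (R / r) powr 2" if "0 < r" "r \<le> R"
    for x :: "real \<times> real" and r R :: real
  proof -
    have "cball x R \<inter> F \<subseteq> {fst x - R..fst x + R} \<times> {snd x - R..snd x + R}"
      using cball_subset_rectangle by blast
    from grid_count_le_rectangle[OF that(1) _ _ this]
    have "real (grid_count (cball x R \<inter> F) r) \<le> (2 * (R / r) + 2) * (2 * (R / r) + 2)"
      using that by simp
    also have "\<dots> \<le> (4 * (R / r)) * (4 * (R / r))"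
      using that by (intro mult_mono) (simp_all add: field_simps)
    also have "\<dots> = 16 * (R / r) powr 2"
      using that by (simp add: power2_eq_square)
    finally show ?thesis .
  qed
  then show ?thesis
    unfolding homogeneous_def by (intro exI[of _ 16]) auto
qed

lemma homogeneous_exponent_ge:
  assumes "homogeneous s F" and "K \<ge> 1"
    and many: "\<And>n::nat. n \<ge> 1 \<Longrightarrow>
      \<exists>x\<in>F. \<exists>r>0. real n powr d \<le> real (grid_count (cball x (K * real n * r) \<inter> F) r)"
  shows "d \<le> s"
proof (rule ccontr)
  assume "\<not> d \<le> s"
  obtain C where count_le: "\<And>R r x. 0 < r \<Longrightarrow> r \<le> R \<Longrightarrow> x \<in> F \<Longrightarrow>
      real (grid_count (cball x R \<inter> F) r) \<le> C * (R / r) powr s"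
    using assms(1) unfolding homogeneous_def by (metis greaterThanAtMost_iff less_le_trans)
  have bound: "real n powr (d - s) \<le> C * K powr s" if n_ge: "n \<ge> 1" for n :: nat
  proof -
    obtain x r where "x \<in> F" "r > 0"
      and count_ge: "real n powr d \<le> real (grid_count (cball x (K * real n * r) \<inter> F) r)"
      using many[OF n_ge] by blast
    have "1 \<le> K * real n"
      using n_ge \<open>K \<ge> 1\<close> mult_mono[of 1 K 1 "real n"] by simp
    then have "real n powr d \<le> C * (K * real n * r / r) powr s"
      using order_trans[OF count_ge count_le[of r "K * real n * r" x]] \<open>x \<in> F\<close> \<open>r > 0\<close> by simp
    also have "\<dots> = C * K powr s * real n powr s"
      using \<open>r > 0\<close> \<open>K \<ge> 1\<close> by (simp add: powr_mult)
    finally show ?thesis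
      using n_ge by (simp add: powr_diff field_simps)
  qed
  have "filterlim (\<lambda>n. real n powr (d - s)) at_top sequentially"
    using \<open>\<not> d \<le> s\<close>
    by (intro filterlim_compose[OF real_powr_at_top filterlim_real_sequentially]) simp
  then have "\<forall>\<^sub>F n in sequentially. C * K powr s < real n powr (d - s)"
    by (simp add: filterlim_at_top_dense)
  then have "\<forall>\<^sub>F n::nat in sequentially. False"
    using eventually_ge_at_top[of 1] by eventually_elim (use bound in fastforce)
  then show False
    by simp
qed

definition grid_saturated :: "nat \<Rightarrow> real \<Rightarrow> (real \<times> real) set \<Rightarrow> bool" where
  "grid_saturated n r F \<longleftrightarrow>
     (\<exists>x\<in>F. real n ^ 2 \<le> real (grid_count (cball x (2 * real n * r) \<inter> F) r))"

lemma assouad_dim_eq_2I: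
  assumes "\<And>n. n \<ge> 1 \<Longrightarrow> \<exists>r>0. grid_saturated n r F"
  shows "assouad_dim F = 2"
  unfolding assouad_dim_def
proof (rule cInf_eq_minimum)
  show "2 \<in> {s. 0 \<le> s \<and> homogeneous s F}"
    by (simp add: homogeneous_two)
  fix s assume "s \<in> {s. 0 \<le> s \<and> homogeneous s F}"
  then have "homogeneous s F"
    by simp
  then show "2 \<le> s"
  proof (rule homogeneous_exponent_ge)
    fix n :: nat assume "n \<ge> 1"
    then have "real n powr 2 = real n ^ 2"
      by simp
    then show "\<exists>x\<in>F. \<exists>r>0. real n powr 2 \<le> real (grid_count (cball x (2 * real n * r) \<inter> F) r)"
      using assms[OF \<open>n \<ge> 1\<close>] unfolding grid_saturated_def by metis
  qed simp
qed

lemma grid_interval_subset: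
  assumes "r > 0" "i \<in> {k..<k + int n}"
  shows "grid_interval r i \<subseteq> {of_int k * r..of_int k * r + real n * r}"
proof -
  have "real_of_int k \<le> of_int i" "real_of_int (i + 1) \<le> of_int (k + int n)"
    using assms(2) by (simp_all only: of_int_le_iff) auto
  then have "of_int k * r \<le> of_int i * r" "(of_int i + 1) * r \<le> (of_int k + real n) * r"
    using assms(1) by simp_all
  then show ?thesis
    by (auto simp: grid_interval_def distrib_right)
qed

lemma grid_line_mem:
  assumes "r > 0" "j \<in> {\<lceil>u / r\<rceil>..<\<lceil>u / r\<rceil> + int n}"
  shows "of_int j * r \<in> {u..u + real n * r}"
proof -
  have "real_of_int (j + 1) \<le> real_of_int (\<lceil>u / r\<rceil> + int n)"
    using assms(2) by (simp only: of_int_le_iff) auto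
  then have "u / r \<le> of_int j" "of_int j \<le> u / r + real n"
    using assms(2) by (auto simp: ceiling_le_iff) linarith
  then show ?thesis
    using assms(1) by (simp add: field_simps)
qed

lemma dist_le_if_mem_square:
  fixes z z' :: "real \<times> real"
  assumes "z \<in> {a..a + d} \<times> {b..b + d}" "z' \<in> {a..a + d} \<times> {b..b + d}"
  shows "dist z z' \<le> 2 * d"
proof -
  have "dist z z' \<le> \<bar>fst z - fst z'\<bar> + \<bar>snd z - snd z'\<bar>"
    using sqrt_sum_squares_le_sum_abs by (simp add: dist_prod_def dist_real_def)
  also have "\<dots> \<le> d + d"
    using assms by (intro add_mono) auto
  finally show ?thesis
    by simp
qed

lemma grid_saturatedI_columns:
  assumes "r > 0" "n \<ge> 1"
    and column: "\<And>i y. i \<in> {k..<k + int n} \<Longrightarrow> y \<in> {u..u + real n * r} \<Longrightarrow>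
      \<exists>t\<in>grid_interval r i. (t, y) \<in> F"
  shows "grid_saturated n r F"
proof -
  define J where "J = {\<lceil>u / r\<rceil>..<\<lceil>u / r\<rceil> + int n}"
  let ?Q = "{of_int k * r..of_int k * r + real n * r} \<times> {u..u + real n * r}"
  have column_in_Q: "\<exists>t\<in>grid_interval r i. (t, y) \<in> F \<inter> ?Q"
    if "i \<in> {k..<k + int n}" "y \<in> {u..u + real n * r}" for i y
    using column[OF that] that grid_interval_subset[OF \<open>r > 0\<close>] by fast
  have "k \<in> {k..<k + int n}" "u \<in> {u..u + real n * r}"
    using \<open>r > 0\<close> \<open>n \<ge> 1\<close> by simp_all
  then obtain s where start: "(s, u) \<in> F \<inter> ?Q"
    using column_in_Q by blast
  let ?E = "cball (s, u) (2 * real n * r) \<inter> F"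
  have "grid_square r (i, j) \<inter> ?E \<noteq> {}" if i: "i \<in> {k..<k + int n}" and j: "j \<in> J" for i j
  proof -
    obtain t where t: "t \<in> grid_interval r i" "(t, of_int j * r) \<in> F \<inter> ?Q"
      using column_in_Q[OF i grid_line_mem[OF \<open>r > 0\<close>]] j unfolding J_def by blast
    then have "dist (s, u) (t, of_int j * r) \<le> 2 * (real n * r)"
      using start by (blast intro: dist_le_if_mem_square)
    with t have "(t, of_int j * r) \<in> ?E"
      by simp
    moreover have "of_int j * r \<in> grid_interval r j"
      using \<open>r > 0\<close> by (simp add: grid_interval_def)
    ultimately show ?thesis
      using t(1) by (auto simp: grid_square_def)
  qed
  then have "card ({k..<k + int n} \<times> J) \<le> grid_count ?E r"
    using \<open>r > 0\<close> by (intro card_le_grid_count) (auto simp: bounded_Int)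
  then have "real n ^ 2 \<le> real (grid_count ?E r)"
    by (simp add: J_def power2_eq_square flip: of_nat_mult)
  with start show ?thesis
    unfolding grid_saturated_def by blast
qed

section \<open>Intermediate values of cadlag functions\<close>

definition attains_or_jumps_over :: "(real \<Rightarrow> real) \<Rightarrow> real \<Rightarrow> real \<Rightarrow> bool" where
  "attains_or_jumps_over f t y \<longleftrightarrow>
     f t = y \<or> (0 < t \<and> (\<exists>l. (f \<longlongrightarrow> l) (at_left t) \<and> y \<in> closed_segment l (f t)))"

lemma attains_or_jumps_over_uminus:
  assumes "attains_or_jumps_over (\<lambda>s. - f s) t (- y)"
  shows "attains_or_jumps_over f t y"
proof -
  have "(f \<longlongrightarrow> - l) (at_left t)" if "((\<lambda>s. - f s) \<longlongrightarrow> l) (at_left t)" for l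
    using tendsto_minus[OF that] by simp
  moreover have "y \<in> closed_segment (- l) (f t)" if "- y \<in> closed_segment l (- f t)" for l
    using that by (auto simp: closed_segment_eq_real_ivl split: if_splits)
  ultimately show ?thesis
    using assms unfolding attains_or_jumps_over_def by (metis neg_equal_iff_equal)
qed

lemma cadlag_ge_if_ge_right:
  assumes "cadlag f" "0 \<le> t" "t < b" and "\<And>s. s \<in> {t<..<b} \<Longrightarrow> y \<le> f s"
  shows "y \<le> f t"
proof (rule tendsto_lowerbound)
  show "(f \<longlongrightarrow> f t) (at_right t)"
    using assms(1,2) by (simp add: cadlag_def continuous_within)
  show "\<forall>\<^sub>F s in at_right t. y \<le> f s"
    using eventually_at_right_real[OF \<open>t < b\<close>] assms(4) by (rule eventually_mono)
qed simp

lemma left_limit_at_Sup_le: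
  fixes f :: "real \<Rightarrow> 'a::linorder_topology"
  assumes left_limit: "(f \<longlongrightarrow> l) (at_left (Sup S))"
    and "Sup S \<notin> S" "a \<in> S" "bdd_above S" and S_le: "\<And>s. s \<in> S \<Longrightarrow> f s \<le> y"
  shows "l \<le> y"
proof (rule ccontr)
  have less_Sup: "s < Sup S" if "s \<in> S" for s
    using cSup_upper[OF that \<open>bdd_above S\<close>] \<open>Sup S \<notin> S\<close> that by (cases "s = Sup S") auto
  assume "\<not> l \<le> y"
  then have "\<forall>\<^sub>F s in at_left (Sup S). y < f s"
    using left_limit by (intro order_tendstoD) auto
  then obtain c where "c < Sup S" and above: "\<And>s. c < s \<Longrightarrow> s < Sup S \<Longrightarrow> y < f s"
    using eventually_at_left[OF less_Sup[OF \<open>a \<in> S\<close>]] by auto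
  obtain s where "s \<in> S" "c < s"
    using less_cSupD[of S c] \<open>a \<in> S\<close> \<open>c < Sup S\<close> by auto
  with above less_Sup S_le show False
    by (meson not_le)
qed

lemma cadlag_intermediate_value_up:
  assumes "cadlag f" "0 \<le> a" "a \<le> b" and y: "f a \<le> y" "y \<le> f b"
  shows "\<exists>t\<in>{a..b}. attains_or_jumps_over f t y"
proof -
  define S where "S = {s \<in> {a..b}. f s \<le> y}"
  define t where "t = Sup S"
  have "a \<in> S" and bdd: "bdd_above S"
    using \<open>a \<le> b\<close> y by (auto simp: S_def intro: bdd_aboveI[of _ b])
  then have t_mem: "a \<le> t" "t \<le> b"
    unfolding t_def by (auto simp: S_def intro: cSup_upper cSup_least)
  have above: "y < f s" if "t < s" "s \<le> b" for s
    using cSup_upper[OF _ bdd, of s] that t_mem by (force simp: S_def t_def)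
  have "y \<le> f t"
  proof (cases "t = b")
    case False
    then show ?thesis
      using \<open>cadlag f\<close> \<open>0 \<le> a\<close> t_mem above
      by (intro cadlag_ge_if_ge_right[of f t b]) (auto simp: less_imp_le)
  qed (use y in simp)
  show ?thesis
  proof (cases "t \<in> S")
    case True
    with \<open>y \<le> f t\<close> t_mem show ?thesis
      by (auto simp: S_def attains_or_jumps_over_def)
  next
    case False
    then have "a < t"
      using \<open>a \<in> S\<close> t_mem by (cases "t = a") auto
    then obtain l where left_limit: "(f \<longlongrightarrow> l) (at_left t)"
      using \<open>cadlag f\<close> \<open>0 \<le> a\<close> unfolding cadlag_def by (meson le_less_trans)
    then have "l \<le> y"
      using False \<open>a \<in> S\<close> bdd unfolding t_def by (rule left_limit_at_Sup_le) (auto simp: S_def)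
    then have "y \<in> closed_segment l (f t)"
      using \<open>y \<le> f t\<close> by (simp add: closed_segment_eq_real_ivl)
    then show ?thesis
      using t_mem left_limit \<open>a < t\<close> \<open>0 \<le> a\<close>
      by (intro bexI[of _ t]) (auto simp: attains_or_jumps_over_def)
  qed
qed

lemma cadlag_intermediate_value:
  assumes cadlag: "cadlag f" and interval: "0 \<le> a" "a \<le> b"
    and y: "y \<in> closed_segment (f a) (f b)"
  shows "\<exists>t\<in>{a..b}. attains_or_jumps_over f t y"
proof (cases "f a \<le> f b")
  case True
  then show ?thesis
    using cadlag_intermediate_value_up[OF cadlag interval] y by (simp add: closed_segment_eq_real_ivl)
next
  case False
  have "cadlag (\<lambda>s. - f s)"
    using cadlag unfolding cadlag_def by (auto intro!: continuous_minus) (metis tendsto_minus)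
  then have "\<exists>t\<in>{a..b}. attains_or_jumps_over (\<lambda>s. - f s) t (- y)"
    using False y interval
    by (intro cadlag_intermediate_value_up) (auto simp: closed_segment_eq_real_ivl)
  then show ?thesis
    using attains_or_jumps_over_uminus by blast
qed

lemma mem_cadlag_graphI:
  assumes "t \<in> I" and "attains_or_jumps_over f t y"
  shows "(t, y) \<in> cadlag_graph I f"
proof (cases "f t = y")
  case True
  then show ?thesis
    using assms(1) by (simp add: cadlag_graph_def)
next
  case False
  then obtain l where "0 < t" and left_limit: "(f \<longlongrightarrow> l) (at_left t)"
    and y: "y \<in> closed_segment l (f t)"
    using assms(2) by (auto simp: attains_or_jumps_over_def)
  have "l \<noteq> f t"
    using False y by auto
  have "\<not> continuous (at t within {0..}) f"
  proof
    assume "continuous (at t within {0..}) f"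
    then have "(f \<longlongrightarrow> f t) (at t)"
      using \<open>0 < t\<close> at_within_interior[of t "{0..}"] by (simp add: continuous_within)
    then have "(f \<longlongrightarrow> f t) (at_left t)"
      by (simp add: filterlim_at_split)
    with left_limit \<open>l \<noteq> f t\<close> show False
      using tendsto_unique trivial_limit_at_left_real by blast
  qed
  then have "t \<in> discontinuities f"
    using \<open>0 < t\<close> by (simp add: discontinuities_def)
  moreover have "Lim (at_left t) f = l"
    using left_limit by (intro tendsto_Lim) simp
  moreover have "(t, y) \<in> closed_segment (t, l) (t, f t)"
    using y by (auto simp: closed_segment_def algebra_simps)
  ultimately show ?thesis
    using assms(1) unfolding cadlag_graph_def by blast
qed

lemma cadlag_graph_meets_column:
  assumes "cadlag f" "0 \<le> a" "a \<le> b" "{a..b} \<subseteq> I" "y \<in> closed_segment (f a) (f b)"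
  shows "\<exists>t\<in>{a..b}. (t, y) \<in> cadlag_graph I f"
  using cadlag_intermediate_value[OF assms(1-3,5)] assms(4) by (blast intro: mem_cadlag_graphI)

section \<open>Zigzag increments\<close>

text \<open>The height is \<open>2 n\<close> because the \<open>n\<close> unit errors may add up to \<open>n\<close>, which still leaves a range
  of length \<open>n\<close> that all increments cross.\<close>

definition zigzag_box :: "nat \<Rightarrow> nat \<Rightarrow> real set" where
  "zigzag_box n i = (if even i then {2 * real n..2 * real n + 1} else {- 2 * real n..1 - 2 * real n})"

lemma sets_zigzag_box [measurable]: "zigzag_box n i \<in> sets borel"
  by (simp add: zigzag_box_def)

definition scaled_increment :: "real \<Rightarrow> real \<Rightarrow> (real \<Rightarrow> real) \<Rightarrow> nat \<Rightarrow> real" where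
  "scaled_increment c \<tau> g j = (g (real (Suc j) * \<tau>) - g (real j * \<tau>)) / c"

definition zigzags_from :: "nat \<Rightarrow> nat \<Rightarrow> real \<Rightarrow> real \<Rightarrow> (real \<Rightarrow> real) \<Rightarrow> bool" where
  "zigzags_from k n c \<tau> g \<longleftrightarrow> (\<forall>i<n. scaled_increment c \<tau> g (k + i) \<in> zigzag_box n i)"

lemma zigzag_partial_sum_bounds:
  assumes "S 0 = 0" and step: "\<And>i. i < n \<Longrightarrow> S (Suc i) - S i \<in> zigzag_box n i" and "i \<le> n"
  shows "S i \<in> (if even i then {0..real i} else {2 * real n..2 * real n + real i})"
  using \<open>i \<le> n\<close>
proof (induction i)
  case 0
  then show ?case
    using \<open>S 0 = 0\<close> by simp
next
  case (Suc i)
  then show ?case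
    using step[of i] by (auto simp: zigzag_box_def split: if_splits)
qed

lemma zigzag_crossing:
  assumes "S 0 = 0" and "\<And>i. i < n \<Longrightarrow> S (Suc i) - S i \<in> zigzag_box n i" and "i < n"
  shows "{real n..2 * real n} \<subseteq> closed_segment (S i) (S (Suc i))"
  using zigzag_partial_sum_bounds[of S n i] zigzag_partial_sum_bounds[of S n "Suc i"] assms
  by (auto simp: closed_segment_eq_real_ivl split: if_splits)

lemma zigzags_from_crossing:
  assumes zigzag: "zigzags_from k n c \<tau> f" and "c > 0" "i < n"
  shows "{f (real k * \<tau>) + real n * c..f (real k * \<tau>) + 2 * real n * c} \<subseteq>
    closed_segment (f (real (k + i) * \<tau>)) (f (real (Suc (k + i)) * \<tau>))"
proof
  define S where "S i = (f (real (k + i) * \<tau>) - f (real k * \<tau>)) / c" for i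
  have "S (Suc i) - S i \<in> zigzag_box n i" if "i < n" for i
    using zigzag that by (simp add: zigzags_from_def scaled_increment_def S_def flip: diff_divide_distrib)
  then have "{real n..2 * real n} \<subseteq> closed_segment (S i) (S (Suc i))"
    using \<open>i < n\<close> by (intro zigzag_crossing) (auto simp: S_def)
  moreover fix y
  assume "y \<in> {f (real k * \<tau>) + real n * c..f (real k * \<tau>) + 2 * real n * c}"
  then have "(y - f (real k * \<tau>)) / c \<in> {real n..2 * real n}"
    using \<open>c > 0\<close> by (simp add: field_simps)
  ultimately have "(y - f (real k * \<tau>)) / c \<in> closed_segment (S i) (S (Suc i))"
    by blast
  then show "y \<in> closed_segment (f (real (k + i) * \<tau>)) (f (real (Suc (k + i)) * \<tau>))"
    using \<open>c > 0\<close>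
    by (auto simp: S_def closed_segment_eq_real_ivl divide_le_cancel split: if_splits)
qed

lemma grid_saturatedI_zigzags_from:
  assumes "cadlag f" and "n \<ge> 1" and "0 < \<tau>" "\<tau> \<le> c"
    and interval: "{real k * \<tau>..real (k + n) * \<tau>} \<subseteq> I"
    and zigzag: "zigzags_from k n c \<tau> f"
  shows "grid_saturated n \<tau> (cadlag_graph I f)"
proof (rule grid_saturatedI_columns[OF \<open>0 < \<tau>\<close> \<open>n \<ge> 1\<close>])
  fix j y
  assume j: "j \<in> {int k..<int k + int n}"
    and y: "y \<in> {f (real k * \<tau>) + real n * c..f (real k * \<tau>) + real n * c + real n * \<tau>}"
  define i where "i = nat j - k"
  have i: "i < n" "j = int (k + i)"
    using j by (auto simp: i_def)
  let ?a = "real (k + i) * \<tau>" and ?b = "real (Suc (k + i)) * \<tau>"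
  have "real n * \<tau> \<le> real n * c"
    using \<open>\<tau> \<le> c\<close> by (simp add: mult_left_mono)
  then have "y \<in> {f (real k * \<tau>) + real n * c..f (real k * \<tau>) + 2 * real n * c}"
    using y by simp
  then have "y \<in> closed_segment (f ?a) (f ?b)"
    using zigzags_from_crossing[OF zigzag _ i(1)] \<open>0 < \<tau>\<close> \<open>\<tau> \<le> c\<close> by force
  moreover have "{?a..?b} \<subseteq> {real k * \<tau>..real (k + n) * \<tau>}"
    using i(1) \<open>0 < \<tau>\<close> unfolding atLeastatMost_subset_iff
    by (intro disjI2 conjI mult_right_mono) auto
  with interval have "{?a..?b} \<subseteq> I"
    by blast
  ultimately have "\<exists>t\<in>{?a..?b}. (t, y) \<in> cadlag_graph I f"
    using \<open>cadlag f\<close> \<open>0 < \<tau>\<close> by (intro cadlag_graph_meets_column mult_right_mono) auto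
  then show "\<exists>t\<in>grid_interval \<tau> j. (t, y) \<in> cadlag_graph I f"
    by (simp add: i(2) grid_interval_def add.commute)
qed

section \<open>Blocks of independent random variables\<close>

lemma (in prob_space) indep_vars_reindex:
  assumes inj: "inj_on h I" and indep: "indep_vars N X (h ` I)"
  shows "indep_vars (\<lambda>i. N (h i)) (\<lambda>i. X (h i)) I"
  unfolding indep_vars_def2
proof (intro conjI ballI indep_setsI)
  let ?G = "\<lambda>j. {X j -` A \<inter> space M | A. A \<in> sets (N j)}"
  fix E J assume J: "J \<noteq> {}" "J \<subseteq> I" "finite J" and E: "\<forall>i\<in>J. E i \<in> ?G (h i)"
  have inj_J: "inj_on h J"
    using inj J(2) by (rule inj_on_subset)
  have "prob (\<Inter>j\<in>h ` J. E (the_inv_into J h j)) = (\<Prod>j\<in>h ` J. prob (E (the_inv_into J h j)))"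
    using J E inj_J indep unfolding indep_vars_def2
    by (intro indep_setsD[where F = ?G and I = "h ` I"]) (auto simp: the_inv_into_f_f)
  then show "prob (\<Inter>i\<in>J. E i) = (\<Prod>i\<in>J. prob (E i))"
    using inj_J by (simp add: prod.reindex the_inv_into_f_f)
qed (use indep in \<open>auto simp: indep_vars_def2 indep_sets_def\<close>)

lemma (in prob_space) prob_Ball_indep_vars:
  assumes indep: "indep_vars N X I" and J: "finite J" "J \<subseteq> I"
    and A_sets: "\<And>j. j \<in> J \<Longrightarrow> A j \<in> sets (N j)"
  shows "prob {\<omega> \<in> space M. \<forall>j\<in>J. X j \<omega> \<in> A j} = (\<Prod>j\<in>J. prob {\<omega> \<in> space M. X j \<omega> \<in> A j})"
proof (cases "J = {}")
  case False
  have "prob {\<omega> \<in> space M. \<forall>j\<in>J. X j \<omega> \<in> A j} = prob (\<Inter>j\<in>J. X j -` A j \<inter> space M)"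
    using False by (intro arg_cong[where f = prob]) auto
  also have "\<dots> = (\<Prod>j\<in>J. prob (X j -` A j \<inter> space M))"
    using False J A_sets by (intro indep_varsD[OF indep])
  finally show ?thesis
    by (simp add: vimage_def Int_def conj_commute)
qed (simp add: prob_space)

lemma (in prob_space) indep_vars_Ball_blocks:
  assumes indep: "indep_vars N X I"
    and K_finite: "\<And>b. b \<in> L \<Longrightarrow> finite (K b)" and K_subset: "\<And>b. b \<in> L \<Longrightarrow> K b \<subseteq> I"
    and K_disjoint: "disjoint_family_on K L"
    and A_sets: "\<And>i. i \<in> I \<Longrightarrow> A i \<in> sets (N i)"
  shows "indep_vars (\<lambda>_. count_space UNIV) (\<lambda>b \<omega>. \<forall>i\<in>K b. X i \<omega> \<in> A i) L"
proof -
  have "indep_vars (\<lambda>_. count_space UNIV)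
      (\<lambda>b \<omega>. \<forall>i\<in>K b. restrict (\<lambda>i. X i \<omega>) (K b) i \<in> A i) L"
  proof (rule indep_vars_compose2[OF indep_vars_restrict[OF indep K_subset K_disjoint]])
    fix b assume b: "b \<in> L"
    have "Measurable.pred (PiM (K b) N) (\<lambda>x. x i \<in> A i)" if "i \<in> K b" for i
      using that K_subset[OF b] by (intro pred_sets2[OF A_sets] measurable_component_singleton) auto
    then show "(\<lambda>x. \<forall>i\<in>K b. x i \<in> A i) \<in> measurable (PiM (K b) N) (count_space UNIV)"
      using K_finite[OF b] by (intro pred_intros_finite)
  qed
  then show ?thesis
    by simp
qed

lemma (in prob_space) prob_no_full_block:
  assumes indep: "indep_vars N X I" and "finite L"
    and K_finite: "\<And>b. b \<in> L \<Longrightarrow> finite (K b)" and K_subset: "\<And>b. b \<in> L \<Longrightarrow> K b \<subseteq> I"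
    and K_disjoint: "disjoint_family_on K L"
    and A_sets: "\<And>i. i \<in> I \<Longrightarrow> A i \<in> sets (N i)"
  shows "prob {\<omega> \<in> space M. \<not> (\<exists>b\<in>L. \<forall>i\<in>K b. X i \<omega> \<in> A i)} =
    (\<Prod>b\<in>L. 1 - (\<Prod>i\<in>K b. prob {\<omega> \<in> space M. X i \<omega> \<in> A i}))"
proof -
  let ?Y = "\<lambda>b \<omega>. \<forall>i\<in>K b. X i \<omega> \<in> A i"
  have indep_Y: "indep_vars (\<lambda>_. count_space UNIV) ?Y L"
    using indep K_finite K_subset K_disjoint A_sets by (rule indep_vars_Ball_blocks)
  have "prob {\<omega> \<in> space M. \<not> (\<exists>b\<in>L. ?Y b \<omega>)} = (\<Prod>b\<in>L. prob {\<omega> \<in> space M. ?Y b \<omega> \<in> {False}})"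
    using prob_Ball_indep_vars[OF indep_Y \<open>finite L\<close> subset_refl, of "\<lambda>_. {False}"] by simp
  also have "\<dots> = (\<Prod>b\<in>L. 1 - (\<Prod>i\<in>K b. prob {\<omega> \<in> space M. X i \<omega> \<in> A i}))"
  proof (rule prod.cong)
    fix b assume b: "b \<in> L"
    have "random_variable (count_space UNIV) (?Y b)"
      using indep_Y b by (simp add: indep_vars_def)
    then have "prob {\<omega> \<in> space M. \<not> ?Y b \<omega>} = 1 - prob {\<omega> \<in> space M. ?Y b \<omega>}"
      by (intro prob_neg) (simp add: pred_def)
    also have "prob {\<omega> \<in> space M. ?Y b \<omega>} = (\<Prod>i\<in>K b. prob {\<omega> \<in> space M. X i \<omega> \<in> A i})"
      using K_finite[OF b] K_subset[OF b] A_sets by (intro prob_Ball_indep_vars[OF indep]) auto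
    finally show "prob {\<omega> \<in> space M. ?Y b \<omega> \<in> {False}} =
        1 - (\<Prod>i\<in>K b. prob {\<omega> \<in> space M. X i \<omega> \<in> A i})"
      by simp
  qed simp
  finally show ?thesis .
qed

lemma disjoint_family_blocks: "disjoint_family (\<lambda>b::nat. (+) (b * n) ` {..<n})"
proof -
  have "j div n = b" if "j \<in> (+) (b * n) ` {..<n}" for j b
    using that by auto
  then show ?thesis
    unfolding disjoint_family_on_def by fastforce
qed

lemma block_subset:
  fixes b m n :: nat
  assumes "b < m"
  shows "(+) (b * n) ` {..<n} \<subseteq> {..<m * n}"
proof -
  have "Suc b * n \<le> m * n"
    using assms by (intro mult_le_mono1) simp
  then show ?thesis
    by auto
qed

lemma (in prob_space) AE_ex_if_prob_not_tendsto_0: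
  assumes events: "\<And>m. {\<omega> \<in> space M. P m \<omega>} \<in> events"
    and lim: "(\<lambda>m::nat. prob {\<omega> \<in> space M. \<not> P m \<omega>}) \<longlonglongrightarrow> 0"
  shows "AE \<omega> in M. \<exists>m. P m \<omega>"
proof -
  have [measurable]: "Measurable.pred M (P m)" for m
    using events by (simp add: pred_def)
  have "prob {\<omega> \<in> space M. \<forall>m. \<not> P m \<omega>} \<le> prob {\<omega> \<in> space M. \<not> P m \<omega>}" for m
    by (rule finite_measure_mono) auto
  then have "prob {\<omega> \<in> space M. \<forall>m. \<not> P m \<omega>} \<le> 0"
    using lim by (intro LIMSEQ_le_const) auto
  then have "prob {\<omega> \<in> space M. \<not> (\<exists>m. P m \<omega>)} = 0"
    by (simp add: measure_le_0_iff)
  then show ?thesis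
    by (subst (asm) prob_Collect_eq_0) auto
qed

lemma (in prob_space) prob_pos_if_density_nonzero:
  assumes dens: "distributed M N Z f" and nonzero: "AE x in N. f x \<noteq> 0"
    and A: "A \<in> sets N" "emeasure N A \<noteq> 0"
  shows "prob {\<omega> \<in> space M. Z \<omega> \<in> A} > 0"
proof (rule ccontr)
  have [measurable]: "Z \<in> measurable M N"
    using dens by (rule distributed_measurable)
  assume "\<not> prob {\<omega> \<in> space M. Z \<omega> \<in> A} > 0"
  then have "prob (Z -` A \<inter> space M) = 0"
    by (simp add: vimage_def Int_def conj_commute zero_less_measure_iff)
  then have "A \<in> null_sets (density N f)"
    using A by (simp add: null_sets_def emeasure_distr emeasure_eq_measure
        flip: distributed_distr_eq_density[OF dens])
  then have "AE x in N. x \<in> A \<longrightarrow> f x = 0"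
    using distributed_borel_measurable[OF dens] by (simp add: null_sets_density_iff)
  with nonzero have "AE x in N. x \<notin> A"
    by eventually_elim auto
  with A show False
    by (simp flip: AE_iff_null_sets) (simp add: null_sets_def)
qed

section \<open>Self-similar Levy processes\<close>

context levy_process
begin

lemma random_variable_scaled_increment:
  assumes "\<tau> \<ge> 0"
  shows "random_variable borel (\<lambda>\<omega>. scaled_increment c \<tau> (\<lambda>t. X t \<omega>) j)"
  unfolding scaled_increment_def using assms
  by (intro borel_measurable_divide borel_measurable_diff borel_measurable_const random_variable) auto

lemma indep_vars_scaled_increment:
  assumes "\<tau> > 0"
  shows "indep_vars (\<lambda>_. borel) (\<lambda>j \<omega>. scaled_increment c \<tau> (\<lambda>t. X t \<omega>) j) {..<N}"
proof -
  have "indep_vars (\<lambda>_. borel) (\<lambda>j \<omega>. X (real j * \<tau>) \<omega> - X (real (j - 1) * \<tau>) \<omega>) {1..N}"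
    using independent_increments[of "\<lambda>i. real i * \<tau>" N] assms by simp
  then have "indep_vars (\<lambda>_. borel) (\<lambda>j \<omega>. X (real (Suc j) * \<tau>) \<omega> - X (real j * \<tau>) \<omega>) {..<N}"
    using indep_vars_reindex[of Suc "{..<N}" "\<lambda>_. borel"
        "\<lambda>j \<omega>. X (real j * \<tau>) \<omega> - X (real (j - 1) * \<tau>) \<omega>"]
    by (simp add: image_Suc_lessThan)
  then show ?thesis
    unfolding scaled_increment_def by (rule indep_vars_compose2) simp
qed

lemma distr_increment:
  assumes "t \<ge> 0" "h > 0"
  shows "distr M borel (\<lambda>\<omega>. X (t + h) \<omega> - X t \<omega>) = distr M borel (X h)"
proof (cases "t = 0")
  case True
  have "AE \<omega> in M. X (t + h) \<omega> - X t \<omega> = X h \<omega>"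
    using start_zero by eventually_elim (simp add: True)
  then show ?thesis
    using assms by (intro distr_cong_AE borel_measurable_diff random_variable) auto
qed (use assms stationary_increments in simp)

lemma distr_scaled_increment:
  assumes scaling: "scaling_property M \<beta> X" and "\<tau> > 0"
  shows "distr M borel (\<lambda>\<omega>. scaled_increment (\<tau> powr (1 / \<beta>)) \<tau> (\<lambda>t. X t \<omega>) j) = distr M borel (X 1)"
proof -
  let ?c = "\<tau> powr (1 / \<beta>)"
  have [measurable]: "random_variable borel (X (real i * \<tau>))" "random_variable borel (X \<tau>)" for i
    using \<open>\<tau> > 0\<close> by (auto intro: random_variable)
  have "distr M borel (\<lambda>\<omega>. scaled_increment ?c \<tau> (\<lambda>t. X t \<omega>) j) =
      distr (distr M borel (\<lambda>\<omega>. X (real (Suc j) * \<tau>) \<omega> - X (real j * \<tau>) \<omega>)) borel (\<lambda>x. x / ?c)"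
    unfolding scaled_increment_def by (subst distr_distr) (auto simp: comp_def simp del: of_nat_Suc)
  also have "\<dots> = distr (distr M borel (X \<tau>)) borel (\<lambda>x. x / ?c)"
    using distr_increment[of "real j * \<tau>" \<tau>] \<open>\<tau> > 0\<close> by (simp add: algebra_simps)
  also have "\<dots> = distr M borel (\<lambda>\<omega>. \<tau> powr (- 1 / \<beta>) * X (\<tau> * 1) \<omega>)"
    by (subst distr_distr) (auto simp: comp_def powr_minus_divide field_simps)
  also have "\<dots> = distr M borel (X 1)"
    using scaling \<open>\<tau> > 0\<close> unfolding scaling_property_def by (metis zero_less_one)
  finally show ?thesis .
qed

lemma prob_scaled_increment_mem:
  assumes "scaling_property M \<beta> X" "\<tau> > 0" "B \<in> sets borel"
  shows "prob {\<omega> \<in> space M. scaled_increment (\<tau> powr (1 / \<beta>)) \<tau> (\<lambda>t. X t \<omega>) j \<in> B} =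
    prob {\<omega> \<in> space M. X 1 \<omega> \<in> B}"
proof -
  have "prob {\<omega> \<in> space M. Z \<omega> \<in> B} = measure (distr M borel Z) B" if "random_variable borel Z" for Z
    using that \<open>B \<in> sets borel\<close> by (simp add: measure_distr vimage_def Int_def conj_commute)
  then show ?thesis
    using assms by (simp add: random_variable_scaled_increment random_variable distr_scaled_increment)
qed

lemma prob_no_zigzag_block:
  assumes "scaling_property M \<beta> X" "\<tau> > 0"
  shows "prob {\<omega> \<in> space M. \<not> (\<exists>b<m. zigzags_from (b * n) n (\<tau> powr (1 / \<beta>)) \<tau> (\<lambda>t. X t \<omega>))} =
    (1 - (\<Prod>i<n. prob {\<omega> \<in> space M. X 1 \<omega> \<in> zigzag_box n i})) ^ m"
proof -
  let ?\<xi> = "\<lambda>j \<omega>. scaled_increment (\<tau> powr (1 / \<beta>)) \<tau> (\<lambda>t. X t \<omega>) j"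
  let ?K = "\<lambda>b. (+) (b * n) ` {..<n}"
  have "prob {\<omega> \<in> space M. \<not> (\<exists>b\<in>{..<m}. \<forall>j\<in>?K b. ?\<xi> j \<omega> \<in> zigzag_box n (j mod n))} =
      (\<Prod>b<m. 1 - (\<Prod>j\<in>?K b. prob {\<omega> \<in> space M. ?\<xi> j \<omega> \<in> zigzag_box n (j mod n)}))"
    using block_subset disjoint_family_on_mono[OF subset_UNIV disjoint_family_blocks]
    by (intro prob_no_full_block[OF indep_vars_scaled_increment[OF \<open>\<tau> > 0\<close>, of _ "m * n"]]
        sets_zigzag_box) auto
  also have "\<dots> = (\<Prod>b<m. 1 - (\<Prod>i<n. prob {\<omega> \<in> space M. X 1 \<omega> \<in> zigzag_box n i}))"
    by (simp add: prob_scaled_increment_mem[OF assms sets_zigzag_box] prod.reindex)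
  finally show ?thesis
    by (simp add: zigzags_from_def Ball_def Bex_def)
qed

lemma AE_exists_zigzag_block:
  assumes scaling: "scaling_property M \<beta> X"
    and density: "distributed M lborel (X 1) f" "AE x in lborel. f x \<noteq> 0" and "n \<ge> 1"
  shows "AE \<omega> in M. \<exists>m>0. \<exists>b<m. let \<tau> = 1 / real (m * n) in
    zigzags_from (b * n) n (\<tau> powr (1 / \<beta>)) \<tau> (\<lambda>t. X t \<omega>)"
proof -
  define p where "p = (\<Prod>i<n. prob {\<omega> \<in> space M. X 1 \<omega> \<in> zigzag_box n i})"
  have "prob {\<omega> \<in> space M. X 1 \<omega> \<in> zigzag_box n i} > 0" for i
    using density by (intro prob_pos_if_density_nonzero) (auto simp: zigzag_box_def)
  then have p_bounds: "0 < p" "p \<le> 1"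
    unfolding p_def by (auto intro!: prod_pos prod_le_1)
  define \<tau> where "\<tau> m = 1 / real (Suc m * n)" for m
  have \<tau>_pos: "\<tau> m > 0" for m
    using \<open>n \<ge> 1\<close> by (simp add: \<tau>_def del: of_nat_mult of_nat_Suc)
  let ?P = "\<lambda>m \<omega>. \<exists>b<Suc m. zigzags_from (b * n) n (\<tau> m powr (1 / \<beta>)) (\<tau> m) (\<lambda>t. X t \<omega>)"
  have "AE \<omega> in M. \<exists>m. ?P m \<omega>"
  proof (rule AE_ex_if_prob_not_tendsto_0)
    fix m
    have [measurable]: "random_variable borel (\<lambda>\<omega>. scaled_increment c (\<tau> m) (\<lambda>t. X t \<omega>) j)" for c j
      using \<tau>_pos[of m] by (intro random_variable_scaled_increment) simp
    show "{\<omega> \<in> space M. ?P m \<omega>} \<in> events"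
      unfolding zigzags_from_def by measurable
  next
    have "(\<lambda>m. (1 - p) ^ Suc m) \<longlonglongrightarrow> 0"
      using p_bounds by (intro LIMSEQ_Suc LIMSEQ_realpow_zero) auto
    then show "(\<lambda>m. prob {\<omega> \<in> space M. \<not> ?P m \<omega>}) \<longlonglongrightarrow> 0"
      by (simp only: prob_no_zigzag_block[OF scaling \<tau>_pos] p_def)
  qed
  then show ?thesis
    by eventually_elim (use zero_less_Suc in \<open>unfold \<tau>_def Let_def, blast\<close>)
qed

lemma AE_grid_saturated:
  assumes "\<beta> \<ge> 1" and cadlag: "AE \<omega> in M. cadlag (\<lambda>t. X t \<omega>)"
    and "scaling_property M \<beta> X" "distributed M lborel (X 1) f" "AE x in lborel. f x \<noteq> 0" and "n \<ge> 1"
  shows "AE \<omega> in M. \<exists>\<tau>>0. grid_saturated n \<tau> (cadlag_graph {0..1} (\<lambda>t. X t \<omega>))"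
  using cadlag AE_exists_zigzag_block[OF assms(3-6)]
proof eventually_elim
  case (elim \<omega>)
  then obtain m b \<tau> where "m > 0" "b < m" and \<tau>_eq: "\<tau> = 1 / real (m * n)"
    and zigzag: "zigzags_from (b * n) n (\<tau> powr (1 / \<beta>)) \<tau> (\<lambda>t. X t \<omega>)"
    by (auto simp: Let_def)
  have "real (m * n) \<ge> 1"
    using \<open>n \<ge> 1\<close> \<open>m > 0\<close> by (simp add: Suc_leI flip: of_nat_mult)
  then have "0 < \<tau>" "\<tau> \<le> 1"
    by (simp_all add: \<tau>_eq)
  then have "\<tau> \<le> \<tau> powr (1 / \<beta>)"
    using powr_mono'[of "1 / \<beta>" 1 \<tau>] \<open>\<beta> \<ge> 1\<close> by simp
  moreover have "real (b * n + n) \<le> real (m * n)"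
    using mult_le_mono1[of "Suc b" m n] \<open>b < m\<close> by (intro of_nat_mono) simp
  then have "real (b * n + n) * \<tau> \<le> 1"
    using \<open>real (m * n) \<ge> 1\<close> by (simp add: \<tau>_eq del: of_nat_add of_nat_mult)
  then have "{real (b * n) * \<tau>..real (b * n + n) * \<tau>} \<subseteq> {0..1}"
    using \<open>0 < \<tau>\<close> by auto
  ultimately show ?case
    using grid_saturatedI_zigzags_from[OF elim(1) \<open>n \<ge> 1\<close> \<open>0 < \<tau>\<close> _ _ zigzag] \<open>0 < \<tau>\<close> by blast
qed

end

theorem theorem3p1:
  fixes M :: "'w measure" and X :: "real \<Rightarrow> 'w \<Rightarrow> real"
    and \<beta> :: real and f :: "real \<Rightarrow> ennreal"
  assumes "\<beta> \<ge> 1"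
    and "levy_process M X"
    and "AE \<omega> in M. cadlag (\<lambda>t. X t \<omega>)"
    and "scaling_property M \<beta> X"
    and "distributed M lborel (X 1) f"
    and "AE x in lborel. f x \<noteq> 0"
  shows "AE \<omega> in M. assouad_dim (cadlag_graph {0..1} (\<lambda>t. X t \<omega>)) = 2"
proof -
  have "\<forall>n\<in>{1..}. AE \<omega> in M. \<exists>r>0. grid_saturated n r (cadlag_graph {0..1} (\<lambda>t. X t \<omega>))"
    using levy_process.AE_grid_saturated[OF assms(2,1,3-6)] by simp
  then have "AE \<omega> in M. \<forall>n\<in>{1..}. \<exists>r>0. grid_saturated n r (cadlag_graph {0..1} (\<lambda>t. X t \<omega>))"
    by (simp add: AE_ball_countable)
  then show ?thesis
    by eventually_elim (simp add: assouad_dim_eq_2I)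
qed

end
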